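(* Let $(X,\|\cdot\|)$ be a real normed space, let $n\ge2$, and let $v_1,\ldots,v_n\in X$ be distinct vectors. Let $\mathrm{Sol}$ be the set of all global minimizers over $u\in X$ of $f(u):=\sum_{i=1}^n\|u-v_i\|$. Then a vector $\bar u\in X$ belongs to $\mathrm{Sol}$ if and only if there exist $x_1^*,\ldots,x_n^*\in X^*$ such that $$\sum_{i=1}^n x_i^*=0,\qquad \max_{1\le i\le n}\|x_i^*\|^*=1,$$ $$\langle x_i^*,\bar u-v_i\rangle=\|\bar u-v_i\|,\qquad (\|x_i^*\|^*-1)\cdot\|\bar u-v_i\|=0\qquad(i=1,\ldots,n).$$ Moreover, if $\bar u\in\mathrm{Sol}$, $x_1^*,\ldots,x_n^*$ satisfy these conditions, and $\bar u\notin\{v_1,\ldots,v_n\}$, then $$\mathrm{Sol}=\bigcap_{i=1}^n\big\{u\in X\;\big|\;\langle x_i^*,u-v_i\rangle=\|x_i^*\|^*\cdot\|u-v_i\|\big\}.$$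
   Context: $X^*$ is the topological dual of $X$, $\|\cdot\|^*$ the dual norm on $X^*$, and $\langle\cdot,\cdot\rangle$ the duality pairing. *)

theory Defs
  imports "HOL-Analysis.Bounded_Linear_Function"
begin

text \<open>
  The topological dual of \<open>'a\<close> is the type \<open>'a \<Rightarrow>\<^sub>L real\<close> of bounded linear functionals; its
  \<^const>\<open>norm\<close> is the operator norm, that is, the dual norm, and
  \<^term>\<open>blinfun_apply\<close> is the duality pairing.  Families indexed by \<open>i = 1, \<dots>, n\<close> are functions on
  \<^typ>\<open>nat\<close>, of which only the values on \<open>{1..n}\<close> are used.
\<close>

definition dist_sum :: "nat \<Rightarrow> (nat \<Rightarrow> 'a::real_normed_vector) \<Rightarrow> 'a \<Rightarrow> real" where
  "dist_sum n v u = (\<Sum>i=1..n. norm (u - v i))"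

definition Sol :: "nat \<Rightarrow> (nat \<Rightarrow> 'a::real_normed_vector) \<Rightarrow> 'a set" where
  "Sol n v = {u. \<forall>w. dist_sum n v u \<le> dist_sum n v w}"

definition optimality_conds ::
  "nat \<Rightarrow> (nat \<Rightarrow> 'a::real_normed_vector) \<Rightarrow> 'a \<Rightarrow> (nat \<Rightarrow> 'a \<Rightarrow>\<^sub>L real) \<Rightarrow> bool" where
  "optimality_conds n v u x \<longleftrightarrow>
     (\<Sum>i=1..n. x i) = 0 \<and>
     Max ((\<lambda>i. norm (x i)) ` {1..n}) = 1 \<and>
     (\<forall>i\<in>{1..n}.
        blinfun_apply (x i) (u - v i) = norm (u - v i) \<and>
        (norm (x i) - 1) * norm (u - v i) = 0)"

end

theory Submission
  imports Defs "HOL-Library.Function_Algebras"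
begin

text \<open>
  Necessity is Fermat's rule together with the sum rule for the subdifferential at \<open>ubar\<close>. Both are
  obtained at once from a Hahn--Banach argument on the space of families \<open>(y\<^sub>i)\<close>: with
  \<open>a\<^sub>i = ubar - v\<^sub>i\<close>, minimality says that
  \<open>s y = inf {\<Sum>i. \<parallel>t a\<^sub>i + y\<^sub>i + h\<parallel> - t \<parallel>a\<^sub>i\<parallel> | t \<ge> 0, h}\<close>
  is finite, hence sublinear, and the components of a linear functional below \<open>s\<close> are the
  \<open>x\<^sub>i\<close>. A linear functional below \<open>s\<close> exists because, by Zorn's lemma, there is a
  minimal sublinear functional below \<open>s\<close>, and minimal sublinear functionals are linear.

  Sufficiency and the description of the solution set hold because
  \<open>\<Sum>i. x\<^sub>i (u - v\<^sub>i)\<close> does not depend on \<open>u\<close> and is a termwise lower bound for the objective.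
\<close>

section \<open>Sublinear functionals and the Hahn-Banach theorem\<close>

text \<open>Scaling is an explicit parameter so that the notion also applies to families
  \<open>'i \<Rightarrow> 'a\<close> with pointwise operations. Homogeneity is asked for
  \<open>c > 0\<close> only, which already forces the value 0 at 0.\<close>

definition sublinear :: "(real \<Rightarrow> 'b::ab_group_add \<Rightarrow> 'b) \<Rightarrow> ('b \<Rightarrow> real) \<Rightarrow> bool" where
  "sublinear smul q \<longleftrightarrow>
     (\<forall>x y. q (x + y) \<le> q x + q y) \<and> (\<forall>c>0. \<forall>x. q (smul c x) = c * q x)"

lemma sublinear_zero:
  assumes "vector_space smul" "sublinear smul q"
  shows "q 0 = 0"
proof -
  interpret vector_space smul by fact
  have "q (smul 2 0) = 2 * q 0"
    using assms(2) unfolding sublinear_def by (meson zero_less_numeral)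
  then show ?thesis by simp
qed

lemma sublinear_ge_minus:
  assumes "vector_space smul" "sublinear smul q"
  shows "- q (- x) \<le> q x"
proof -
  have "q (x + - x) \<le> q x + q (- x)"
    using assms(2) unfolding sublinear_def by blast
  then show ?thesis using sublinear_zero[OF assms] by simp
qed

text \<open>Parameters that are nearly optimal for \<open>x\<close> and \<open>y\<close> combine
  into one for \<open>x + y\<close>, and the infimum inherits this. The lemma serves three times:
  for chains in Zorn's lemma, for the competitor of a minimal functional, and for the functional
  built from a minimizer.\<close>

lemma sublinear_INF:
  fixes smul :: "real \<Rightarrow> 'b::ab_group_add \<Rightarrow> 'b" and G :: "'b \<Rightarrow> 'k \<Rightarrow> real"
  assumes "vector_space smul" and "K \<noteq> {}"
    and bdd: "\<And>x. bdd_below (G x ` K)"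
    and add: "\<And>x y k l. k \<in> K \<Longrightarrow> l \<in> K \<Longrightarrow> \<exists>m\<in>K. G (x + y) m \<le> G x k + G y l"
    and smul: "\<And>c x k. c > 0 \<Longrightarrow> k \<in> K \<Longrightarrow> \<exists>m\<in>K. G (smul c x) m \<le> c * G x k"
  shows "sublinear smul (\<lambda>x. INF k\<in>K. G x k)"
proof -
  interpret vector_space smul by fact
  let ?s = "\<lambda>x. INF k\<in>K. G x k"
  have "?s (x + y) \<le> ?s x + ?s y" for x y
  proof -
    have "?s (x + y) - G x k \<le> G y l" if kl: "k \<in> K" "l \<in> K" for k l
    proof -
      obtain m where "m \<in> K" "G (x + y) m \<le> G x k + G y l" using add kl by blast
      then show ?thesis using cINF_lower[OF bdd, of m "x + y"] by linarith
    qed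
    then have "?s (x + y) - G x k \<le> ?s y" if "k \<in> K" for k
      using that \<open>K \<noteq> {}\<close> by (intro cINF_greatest) auto
    then have "?s (x + y) - ?s y \<le> G x k" if "k \<in> K" for k
      using that by (smt (verit))
    then have "?s (x + y) - ?s y \<le> ?s x"
      using \<open>K \<noteq> {}\<close> by (intro cINF_greatest) auto
    then show ?thesis by linarith
  qed
  moreover have le: "?s (smul c x) \<le> c * ?s x" if "c > 0" for c x
  proof -
    have "?s (smul c x) / c \<le> G x k" if k: "k \<in> K" for k
    proof -
      obtain m where "m \<in> K" "G (smul c x) m \<le> c * G x k" using assms(5) \<open>c > 0\<close> k by blast
      then have "?s (smul c x) \<le> c * G x k" using cINF_lower[OF bdd, of m "smul c x"] by linarith
      then show ?thesis using \<open>c > 0\<close> by (simp add: field_simps)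
    qed
    then have "?s (smul c x) / c \<le> ?s x"
      using \<open>K \<noteq> {}\<close> by (intro cINF_greatest) auto
    then show ?thesis using \<open>c > 0\<close> by (simp add: field_simps)
  qed
  moreover have "c * ?s x \<le> ?s (smul c x)" if "c > 0" for c x
  proof -
    \<comment> \<open>The converse inequality is \<open>le\<close> applied to the reciprocal
      scalar.\<close>
    have "?s x \<le> inverse c * ?s (smul c x)"
      using le[of "inverse c" "smul c x"] that by simp
    then show ?thesis using that by (simp add: field_simps)
  qed
  ultimately show ?thesis unfolding sublinear_def by (meson order_antisym)
qed

lemma exists_minimal_sublinear:
  fixes p :: "'b::ab_group_add \<Rightarrow> real"
  assumes vs: "vector_space smul" and p: "sublinear smul p"
  obtains q where "sublinear smul q" "q \<le> p" "\<And>r. sublinear smul r \<Longrightarrow> r \<le> q \<Longrightarrow> r = q"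
proof -
  define A where "A = {q. sublinear smul q \<and> q \<le> p}"
  \<comment> \<open>The order is reversed, so that the maximal element given by Zorn's lemma is
    pointwise minimal.\<close>
  let ?P = "\<lambda>q r :: 'b \<Rightarrow> real. r \<le> q"
  have "\<exists>q\<in>A. \<forall>r\<in>A. ?P q r \<longrightarrow> r = q"
  proof (rule predicate_Zorn)
    show "partial_order_on A (relation_of ?P A)"
      by (rule partial_order_on_relation_ofI) auto
  next
    fix C assume C: "C \<in> Chains (relation_of ?P A)"
    then have CA: "C \<subseteq> A" by (rule Chains_relation_of)
    have tot: "q \<le> r \<or> r \<le> q" if "q \<in> C" "r \<in> C" for q r
      using C that unfolding Chains_def relation_of_def by auto
    show "\<exists>u\<in>A. \<forall>q\<in>C. ?P q u"
    proof (cases "C = {}")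
      case True
      then show ?thesis using p by (auto simp: A_def)
    next
      case False
      let ?u = "\<lambda>x. INF q\<in>C. q x"
      \<comment> \<open>A lower bound that does not depend on \<open>q\<close> keeps the infimum
        over the chain finite.\<close>
      have ge: "- p (- x) \<le> q x" if "q \<in> C" for q x
      proof -
        have q: "sublinear smul q" and "q \<le> p" using that CA by (auto simp: A_def)
        then have "q (- x) \<le> p (- x)" by (simp add: le_fun_def)
        then show ?thesis using sublinear_ge_minus[OF vs q, of x] by linarith
      qed
      have bdd: "bdd_below ((\<lambda>q. q x) ` C)" for x
        using ge by (auto intro!: bdd_belowI2)
      have "sublinear smul ?u"
      proof (rule sublinear_INF[OF vs False bdd])
        fix x y q r assume qr: "q \<in> C" "r \<in> C"
        \<comment> \<open>The smaller of two members of the chain works for both arguments at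
          once.\<close>
        define m where "m = (if q \<le> r then q else r)"
        have "m \<in> C" "m \<le> q" "m \<le> r" using tot[OF qr] qr by (auto simp: m_def)
        moreover have "m (x + y) \<le> m x + m y"
          using \<open>m \<in> C\<close> CA by (auto simp: A_def sublinear_def)
        ultimately show "\<exists>m\<in>C. m (x + y) \<le> q x + r y"
          by (meson add_mono le_funD order_trans)
      next
        fix c :: real and x q assume "c > 0" "q \<in> C"
        then show "\<exists>m\<in>C. m (smul c x) \<le> c * q x"
          using CA by (intro bexI[of _ q]) (auto simp: A_def sublinear_def)
      qed
      moreover have below: "?u \<le> q" if "q \<in> C" for q
        using cINF_lower[OF bdd that] by (simp add: le_fun_def)
      moreover have "?u \<le> p"
      proof -
        obtain q where "q \<in> C" using False by blast
        then show ?thesis using below CA by (force simp: A_def)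
      qed
      ultimately show ?thesis by (auto simp: A_def)
    qed
  qed
  then obtain q where "q \<in> A" "\<And>r. r \<in> A \<Longrightarrow> r \<le> q \<Longrightarrow> r = q" by blast
  then show thesis using that by (auto simp: A_def)
qed

text \<open>A sublinear competitor below \<open>q\<close> must equal \<open>q\<close>, and this
  yields superadditivity. Additivity then makes \<open>q\<close> odd, which extends homogeneity to
  negative scalars.\<close>

lemma minimal_sublinear_imp_linear:
  fixes q :: "'b::ab_group_add \<Rightarrow> real"
  assumes vs: "vector_space smul" and q: "sublinear smul q"
    and minimal: "\<And>r. sublinear smul r \<Longrightarrow> r \<le> q \<Longrightarrow> r = q"
  shows "Vector_Spaces.linear smul (*) q"
proof -
  interpret vector_space smul by fact
  have sub: "q (x + y) \<le> q x + q y" and pos: "c > 0 \<Longrightarrow> q (smul c x) = c * q x" for x y c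
    using q by (auto simp: sublinear_def)
  have q0: "q 0 = 0" by (rule sublinear_zero[OF vs q])
  have nonneg: "q (smul c x) = c * q x" if "c \<ge> 0" for c x
    using that pos q0 by (cases "c = 0") auto
  have super: "q x + q y \<le> q (x + y)" for x y
  proof -
    \<comment> \<open>the largest sublinear functional below \<open>q\<close> whose value at \<open>- y\<close> is at most \<open>- q y\<close>\<close>
    let ?G = "\<lambda>x t. q (x + smul t y) - t * q y"
    let ?r = "\<lambda>x. INF t\<in>{0..}. ?G x t"
    \<comment> \<open>Subadditivity gives
      \<open>t * q y = q (smul t y) \<le> q (x + smul t y) + q (- x)\<close>.\<close>
    have bdd: "bdd_below (?G x ` {0..})" for x
    proof (rule bdd_belowI2)
      fix t :: real assume "t \<in> {0..}"
      then show "- q (- x) \<le> ?G x t"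
        using sub[of "x + smul t y" "- x"] nonneg[of t y] by simp
    qed
    have "sublinear smul ?r"
    proof (rule sublinear_INF[OF vs _ bdd])
      fix x x' and t t' :: real assume "t \<in> {0..}" "t' \<in> {0..}"
      then show "\<exists>m\<in>{0..}. ?G (x + x') m \<le> ?G x t + ?G x' t'"
        using sub[of "x + smul t y" "x' + smul t' y"]
        by (intro bexI[of _ "t + t'"]) (auto simp: algebra_simps scale_left_distrib)
    next
      fix c t :: real and x assume "c > 0" "t \<in> {0..}"
      then show "\<exists>m\<in>{0..}. ?G (smul c x) m \<le> c * ?G x t"
        using pos[of c "x + smul t y"]
        by (intro bexI[of _ "c * t"]) (auto simp: algebra_simps scale_right_distrib)
    qed auto
    moreover have "?r \<le> q"
      using cINF_lower[OF bdd, of 0] by (auto simp: le_fun_def)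
    ultimately have "?r = q" by (rule minimal)
    then have "q x = ?r x" by (simp only: fun_eq_iff)
    also have "\<dots> \<le> ?G x 1" by (rule cINF_lower[OF bdd]) simp
    finally show ?thesis by simp
  qed
  have add: "q (x + y) = q x + q y" for x y
    using sub super by (rule order_antisym)
  have neg: "q (- x) = - q x" for x
    using add[of x "- x"] q0 by simp
  have smul: "q (smul c x) = c * q x" for c x
    using nonneg[of c x] nonneg[of "- c" x] neg[of "smul c x"]
    by (cases "c \<ge> 0") auto
  have "vector_space ((*) :: real \<Rightarrow> real \<Rightarrow> real)"
    by unfold_locales (auto simp: algebra_simps)
  then show ?thesis
    using vs add smul
    by (intro module_hom_iff_linear[THEN iffD1])
       (auto simp: module_hom_def module_hom_axioms_def module_iff_vector_space)
qed

theorem Hahn_Banach_sublinear: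
  fixes p :: "'b::ab_group_add \<Rightarrow> real"
  assumes "vector_space smul" and "sublinear smul p"
  obtains f where "Vector_Spaces.linear smul (*) f" "\<And>x. f x \<le> p x"
  using exists_minimal_sublinear[OF assms] minimal_sublinear_imp_linear[OF assms(1)]
  by (metis le_funD)

section \<open>Functionals obtained from a minimizer\<close>

text \<open>Each \<open>x i\<close> is a subgradient of the norm at \<open>a i\<close>. The three
  conclusions come from evaluating the bound \<open>L y \<le> G y (t, h)\<close> at families
  supported on one index, at constant families, and at the family \<open>- a i\<close>.\<close>

lemma sum_norm_minimizer_functionals:
  fixes a :: "'i \<Rightarrow> 'a::real_normed_vector"
  assumes "finite I" and minimal: "\<And>h. (\<Sum>i\<in>I. norm (a i)) \<le> (\<Sum>i\<in>I. norm (a i + h))"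
  obtains x :: "'i \<Rightarrow> 'a \<Rightarrow>\<^sub>L real"
  where "(\<Sum>i\<in>I. x i) = 0" "\<And>i. i \<in> I \<Longrightarrow> norm (x i) \<le> 1"
    "\<And>i. i \<in> I \<Longrightarrow> blinfun_apply (x i) (a i) = norm (a i)"
proof -
  define smul :: "real \<Rightarrow> ('i \<Rightarrow> 'a) \<Rightarrow> 'i \<Rightarrow> 'a" where "smul = (\<lambda>c y i. c *\<^sub>R y i)"
  have vs: "vector_space smul"
    by unfold_locales (auto simp: smul_def fun_eq_iff algebra_simps)
  define G where "G = (\<lambda>y (t, h). \<Sum>i\<in>I. norm (t *\<^sub>R a i + y i + h) - t * norm (a i))"
  let ?K = "{0..} \<times> UNIV :: (real \<times> 'a) set"
  let ?s = "\<lambda>y. INF k\<in>?K. G y k"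
  \<comment> \<open>For \<open>t > 0\<close> this is minimality at the shift
    \<open>h /\<^sub>R t\<close>, multiplied by \<open>t\<close>.\<close>
  have dil: "(\<Sum>i\<in>I. t * norm (a i)) \<le> (\<Sum>i\<in>I. norm (t *\<^sub>R a i + h))" if "t \<ge> 0" for t h
  proof (cases "t = 0")
    case False
    have "t *\<^sub>R a i + h = t *\<^sub>R (a i + h /\<^sub>R t)" for i
      using False by (simp add: scaleR_right_distrib)
    then have "norm (t *\<^sub>R a i + h) = t * norm (a i + h /\<^sub>R t)" for i
      using that by (metis abs_of_nonneg norm_scaleR)
    then show ?thesis
      using minimal[of "h /\<^sub>R t"] that
      by (simp add: mult_left_mono flip: sum_distrib_left)
  qed (simp add: sum_nonneg)
  \<comment> \<open>Removing \<open>y i\<close> from a term costs at most \<open>norm (y i)\<close>,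
    and \<open>dil\<close> bounds what remains.\<close>
  have bdd: "bdd_below (G y ` ?K)" for y
  proof (rule bdd_belowI2)
    fix k assume "k \<in> ?K"
    then obtain t h where k: "k = (t, h)" and "t \<ge> 0" by auto
    have "norm (t *\<^sub>R a i + h) \<le> norm (t *\<^sub>R a i + y i + h) + norm (y i)" for i
      using norm_triangle_ineq4[of "t *\<^sub>R a i + y i + h" "y i"] by (simp add: algebra_simps)
    then have "(\<Sum>i\<in>I. norm (t *\<^sub>R a i + h))
        \<le> (\<Sum>i\<in>I. norm (t *\<^sub>R a i + y i + h) + norm (y i))"
      by (rule sum_mono)
    then show "- (\<Sum>i\<in>I. norm (y i)) \<le> G y k"
      using dil[OF \<open>t \<ge> 0\<close>, of h] by (simp add: G_def k sum.distrib sum_subtractf)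
  qed
  have "sublinear smul ?s"
  proof (rule sublinear_INF[OF vs _ bdd])
    fix y z k l assume "k \<in> ?K" "l \<in> ?K"
    then obtain t h t' h' where k: "k = (t, h)" "l = (t', h')" and "t \<ge> 0" "t' \<ge> 0" by auto
    have "norm ((t + t') *\<^sub>R a i + (y + z) i + (h + h'))
        \<le> norm (t *\<^sub>R a i + y i + h) + norm (t' *\<^sub>R a i + z i + h')" for i
      using norm_triangle_ineq[of "t *\<^sub>R a i + y i + h" "t' *\<^sub>R a i + z i + h'"]
      by (simp add: algebra_simps)
    then have "norm ((t + t') *\<^sub>R a i + (y + z) i + (h + h')) - (t + t') * norm (a i)
        \<le> (norm (t *\<^sub>R a i + y i + h) - t * norm (a i))
          + (norm (t' *\<^sub>R a i + z i + h') - t' * norm (a i))" for i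
      by (smt (verit) distrib_right)
    then have "G (y + z) (t + t', h + h') \<le> G y k + G z l"
      unfolding k G_def prod.case by (subst sum.distrib[symmetric]) (rule sum_mono)
    then show "\<exists>m\<in>?K. G (y + z) m \<le> G y k + G z l"
      using \<open>t \<ge> 0\<close> \<open>t' \<ge> 0\<close> by (intro bexI) auto
  next
    fix c :: real and y k assume "c > 0" "k \<in> ?K"
    then obtain t h where k: "k = (t, h)" and "t \<ge> 0" by auto
    have "(c * t) *\<^sub>R a i + smul c y i + c *\<^sub>R h = c *\<^sub>R (t *\<^sub>R a i + y i + h)" for i
      by (simp add: smul_def scaleR_right_distrib)
    then have "norm ((c * t) *\<^sub>R a i + smul c y i + c *\<^sub>R h) = c * norm (t *\<^sub>R a i + y i + h)" for i
      using \<open>c > 0\<close> by simp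
    then have "G (smul c y) (c * t, c *\<^sub>R h) = c * G y k"
      by (simp add: G_def k sum_distrib_left right_diff_distrib mult.assoc)
    then show "\<exists>m\<in>?K. G (smul c y) m \<le> c * G y k"
      using \<open>t \<ge> 0\<close> \<open>c > 0\<close> by (intro bexI[of _ "(c * t, c *\<^sub>R h)"]) auto
  qed auto
  with vs obtain L where lin: "Vector_Spaces.linear smul (*) L" and "\<And>y. L y \<le> ?s y"
    using Hahn_Banach_sublinear by blast
  then have L_le: "L y \<le> G y (t, h)" if "t \<ge> 0" for y t h
    using cINF_lower[OF bdd, of "(t, h)" y] that order_trans by fastforce
  interpret L: Vector_Spaces.linear smul "(*)" L by (rule lin)
  \<comment> \<open>\<open>e i\<close> embeds the space as the \<open>i\<close>-th coordinate of the
    space of families.\<close>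
  define e :: "'i \<Rightarrow> 'a \<Rightarrow> 'i \<Rightarrow> 'a" where "e = (\<lambda>i z j. if j = i then z else 0)"
  have e_add: "e i (z + w) = e i z + e i w" and e_scale: "e i (c *\<^sub>R z) = smul c (e i z)" for i z w c
    by (auto simp: e_def smul_def fun_eq_iff)
  have decomp: "L (\<lambda>i. if i \<in> J then y i else 0) = (\<Sum>i\<in>J. L (e i (y i)))" if "finite J" for J y
    using that
  proof (induction J rule: finite_induct)
    case empty
    have "(\<lambda>i. 0) = (0 :: 'i \<Rightarrow> 'a)" by (simp add: fun_eq_iff)
    then show ?case by simp
  next
    case (insert j J)
    have "(\<lambda>i. if i \<in> insert j J then y i else 0) = e j (y j) + (\<lambda>i. if i \<in> J then y i else 0)"
      using insert by (auto simp: e_def fun_eq_iff)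
    then show ?case using insert by (simp add: L.add)
  qed
  have e_le: "L (e i z) \<le> norm z" if "i \<in> I" for i z
  proof -
    have "G (e i z) (0, 0) = (\<Sum>j\<in>I. if j = i then norm z else 0)"
      unfolding G_def prod.case by (intro sum.cong) (auto simp: e_def)
    then show ?thesis using L_le[of 0 "e i z" 0] \<open>finite I\<close> that by simp
  qed
  have e_abs: "\<bar>L (e i z)\<bar> \<le> norm z" if "i \<in> I" for i z
    using e_le[OF that, of z] e_le[OF that, of "- z"] e_scale[of i "-1" z]
    by (simp add: L.neg)
  define x where "x i = Blinfun (\<lambda>z. L (e i z))" for i
  have x_apply: "blinfun_apply (x i) z = L (e i z)" if "i \<in> I" for i z
  proof -
    have "bounded_linear (\<lambda>z. L (e i z))"
      by (rule bounded_linear_intro[of _ 1])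
         (use e_abs[OF that] in \<open>auto simp: e_add e_scale L.add L.scale\<close>)
    then show ?thesis by (simp add: x_def bounded_linear_Blinfun_apply)
  qed
  have sum_x: "(\<Sum>i\<in>I. blinfun_apply (x i) (y i)) = L (\<lambda>i. if i \<in> I then y i else 0)" for y
    using decomp[OF \<open>finite I\<close>] by (simp add: x_apply)
  have diag_le: "(\<Sum>i\<in>I. blinfun_apply (x i) z) \<le> 0" for z
  proof -
    \<comment> \<open>The common shift \<open>h = - z\<close> cancels a constant family. Using
      \<open>z\<close> and \<open>- z\<close> then makes the functionals sum to zero.\<close>
    have "G (\<lambda>i. if i \<in> I then z else 0) (0, - z) = 0"
      unfolding G_def prod.case by (intro sum.neutral) auto
    then show ?thesis
      using L_le[of 0 "\<lambda>i. if i \<in> I then z else 0" "- z"] sum_x[of "\<lambda>i. z"] by linarith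
  qed
  have "(\<Sum>i\<in>I. blinfun_apply (x i) z) = 0" for z
    using diag_le[of z] diag_le[of "- z"] by (simp add: blinfun.minus_right sum_negf)
  then have "(\<Sum>i\<in>I. x i) = 0"
    by (intro blinfun_eqI) (simp add: blinfun.sum_left)
  moreover have norm_le: "norm (x i) \<le> 1" if "i \<in> I" for i
    using e_abs[OF that] by (intro norm_blinfun_bound) (auto simp: x_apply that)
  moreover have "blinfun_apply (x i) (a i) = norm (a i)" if "i \<in> I" for i
  proof -
    \<comment> \<open>With \<open>t = 1\<close> the family \<open>- a i\<close> cancels the base
      point, so the values \<open>x i (a i)\<close> sum to at least the sum of the norms. Since no
      single value exceeds its norm, all are equal.\<close>
    have "G (\<lambda>i. if i \<in> I then - a i else 0) (1, 0) = (\<Sum>i\<in>I. - norm (a i))"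
      unfolding G_def prod.case by (intro sum.cong) auto
    then have "(\<Sum>i\<in>I. blinfun_apply (x i) (- a i)) \<le> (\<Sum>i\<in>I. - norm (a i))"
      using L_le[of 1 "\<lambda>i. if i \<in> I then - a i else 0" 0] sum_x[of "\<lambda>i. - a i"] by linarith
    then have "- (\<Sum>i\<in>I. blinfun_apply (x i) (a i)) \<le> - (\<Sum>i\<in>I. norm (a i))"
      by (simp only: blinfun.minus_right sum_negf)
    then have "(\<Sum>i\<in>I. norm (a i) - blinfun_apply (x i) (a i)) \<le> 0"
      by (simp add: sum_subtractf)
    moreover have nonneg: "0 \<le> norm (a i) - blinfun_apply (x i) (a i)" if "i \<in> I" for i
      using e_le[OF that, of "a i"] x_apply[OF that] by simp
    ultimately have "(\<Sum>i\<in>I. norm (a i) - blinfun_apply (x i) (a i)) = 0"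
      by (intro order_antisym sum_nonneg)
    then show ?thesis
      using sum_nonneg_eq_0_iff[OF \<open>finite I\<close> nonneg] that by simp
  qed
  ultimately show thesis using that by blast
qed

section \<open>Optimality conditions and the solution set\<close>

lemma blinfun_apply_le_norm:
  fixes f :: "'a::real_normed_vector \<Rightarrow>\<^sub>L real"
  assumes "norm f \<le> 1"
  shows "blinfun_apply f z \<le> norm z"
proof -
  have "blinfun_apply f z \<le> norm f * norm z"
    using norm_blinfun[of f z] by simp
  also have "\<dots> \<le> norm z"
    using mult_right_mono[OF assms norm_ge_zero[of z]] by simp
  finally show ?thesis .
qed

text \<open>The two sides differ by the sum of the functionals evaluated at
  \<open>u - w\<close>.\<close>

lemma sum_blinfun_apply_diff_const:
  assumes "(\<Sum>i\<in>I. x i) = 0"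
  shows "(\<Sum>i\<in>I. blinfun_apply (x i) (u - v i)) = (\<Sum>i\<in>I. blinfun_apply (x i) (w - v i))"
proof -
  have "(\<Sum>i\<in>I. blinfun_apply (x i) z) = 0" for z
    using assms by (simp flip: blinfun.sum_left)
  then show ?thesis by (simp add: blinfun.diff_right sum_subtractf)
qed

lemma optimality_conds_norm_le:
  assumes "optimality_conds n v u x" and "i \<in> {1..n}"
  shows "norm (x i) \<le> 1"
  using assms Max_ge[of "(\<lambda>i. norm (x i)) ` {1..n}" "norm (x i)"]
  by (auto simp: optimality_conds_def)

text \<open>Writing the value at \<open>ubar\<close> through an arbitrary \<open>u\<close> makes it
  comparable, term by term, with \<open>dist_sum n v u\<close>.\<close>

lemma optimality_conds_dist_sum:
  assumes "optimality_conds n v ubar x"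
  shows "dist_sum n v ubar = (\<Sum>i=1..n. blinfun_apply (x i) (u - v i))"
proof -
  have "dist_sum n v ubar = (\<Sum>i=1..n. blinfun_apply (x i) (ubar - v i))"
    using assms by (simp add: optimality_conds_def dist_sum_def)
  also have "\<dots> = (\<Sum>i=1..n. blinfun_apply (x i) (u - v i))"
    using assms by (intro sum_blinfun_apply_diff_const) (simp add: optimality_conds_def)
  finally show ?thesis .
qed

lemma optimality_conds_imp_Sol:
  assumes "optimality_conds n v u x"
  shows "u \<in> Sol n v"
  unfolding Sol_def
proof (intro CollectI allI)
  fix w
  have "dist_sum n v u = (\<Sum>i=1..n. blinfun_apply (x i) (w - v i))"
    by (rule optimality_conds_dist_sum[OF assms])
  also have "\<dots> \<le> (\<Sum>i=1..n. norm (w - v i))"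
    by (intro sum_mono blinfun_apply_le_norm optimality_conds_norm_le[OF assms])
  finally show "dist_sum n v u \<le> dist_sum n v w" by (simp add: dist_sum_def)
qed

lemma Sol_imp_optimality_conds:
  assumes "n \<ge> 2" and "inj_on v {1..n}" and "u \<in> Sol n v"
  shows "\<exists>x. optimality_conds n v u x"
proof -
  have "(\<Sum>i=1..n. norm (u - v i)) \<le> (\<Sum>i=1..n. norm (u - v i + h))" for h
  proof -
    have "dist_sum n v u \<le> dist_sum n v (u + h)"
      using assms(3) by (simp add: Sol_def)
    then show ?thesis by (simp add: dist_sum_def diff_add_eq)
  qed
  then obtain x :: "nat \<Rightarrow> 'a \<Rightarrow>\<^sub>L real" where sum: "(\<Sum>i=1..n. x i) = 0"
    and le: "\<And>i. i \<in> {1..n} \<Longrightarrow> norm (x i) \<le> 1"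
    and attained: "\<And>i. i \<in> {1..n} \<Longrightarrow> blinfun_apply (x i) (u - v i) = norm (u - v i)"
    using sum_norm_minimizer_functionals[of "{1..n}" "\<lambda>i. u - v i"] by auto
  \<comment> \<open>A functional of norm at most 1 that attains the norm of a nonzero vector has
    norm exactly 1.\<close>
  have one: "norm (x i) = 1" if "i \<in> {1..n}" "u \<noteq> v i" for i
  proof -
    have "1 * norm (u - v i) \<le> norm (x i) * norm (u - v i)"
      using norm_blinfun[of "x i" "u - v i"] attained[OF that(1)] by simp
    moreover have "0 < norm (u - v i)" using that(2) by simp
    ultimately have "1 \<le> norm (x i)" by (rule mult_right_le_imp_le)
    then show ?thesis using le[OF that(1)] by (rule order_antisym[rotated])
  qed
  \<comment> \<open>Since \<open>u\<close> differs from at least one of \<open>v 1\<close> and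
    \<open>v 2\<close>, the bound 1 is attained and the maximum is exactly 1.\<close>
  have "v 1 \<noteq> v 2" using inj_onD[OF assms(2), of 1 2] assms(1) by auto
  then have "\<exists>i\<in>{1..n}. norm (x i) = 1"
    using one[of 1] one[of 2] assms(1) by (cases "u = v 1") auto
  then have "Max ((\<lambda>i. norm (x i)) ` {1..n}) = 1"
    using le by (intro Max_eqI) (auto simp: image_iff)
  then have "optimality_conds n v u x"
    using sum attained one unfolding optimality_conds_def by auto
  then show ?thesis by blast
qed

text \<open>Away from the points \<open>v i\<close>, complementarity gives every \<open>x i\<close>
  norm 1. The excess of \<open>dist_sum n v u\<close> over the minimum is then a sum of nonnegative
  gaps \<open>norm (u - v i) - x i (u - v i)\<close>, which vanishes exactly when every gap
  does.\<close>

lemma Sol_eq_Inter: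
  assumes x: "optimality_conds n v ubar x" and "ubar \<in> Sol n v" and "ubar \<notin> v ` {1..n}"
  shows "Sol n v =
    (\<Inter>i\<in>{1..n}. {u. blinfun_apply (x i) (u - v i) = norm (x i) * norm (u - v i)})"
proof -
  have one: "norm (x i) = 1" if "i \<in> {1..n}" for i
    using x assms(3) that by (auto simp: optimality_conds_def)
  have "u \<in> Sol n v \<longleftrightarrow> (\<forall>i\<in>{1..n}. blinfun_apply (x i) (u - v i) = norm (u - v i))" for u
  proof -
    have nonneg: "0 \<le> norm (u - v i) - blinfun_apply (x i) (u - v i)" if "i \<in> {1..n}" for i
      using blinfun_apply_le_norm[of "x i" "u - v i"] one[OF that] by simp
    have "u \<in> Sol n v \<longleftrightarrow> dist_sum n v u \<le> dist_sum n v ubar"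
      using assms(2) by (auto simp: Sol_def intro: order_trans)
    also have "\<dots> \<longleftrightarrow> (\<Sum>i=1..n. norm (u - v i) - blinfun_apply (x i) (u - v i)) \<le> 0"
      unfolding optimality_conds_dist_sum[OF x, of u] by (simp add: dist_sum_def sum_subtractf)
    also have "\<dots> \<longleftrightarrow> (\<Sum>i=1..n. norm (u - v i) - blinfun_apply (x i) (u - v i)) = 0"
      using sum_nonneg[of "{1..n}" "\<lambda>i. norm (u - v i) - blinfun_apply (x i) (u - v i)"] nonneg
      by force
    also have "\<dots> \<longleftrightarrow> (\<forall>i\<in>{1..n}. norm (u - v i) - blinfun_apply (x i) (u - v i) = 0)"
      using nonneg by (intro sum_nonneg_eq_0_iff) auto
    finally show ?thesis by auto
  qed
  then show ?thesis using one by auto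
qed

theorem theorem5p1:
  fixes v :: "nat \<Rightarrow> 'a::real_normed_vector" and n :: nat
  assumes "n \<ge> 2" and "inj_on v {1..n}"
  shows "(\<forall>ubar. ubar \<in> Sol n v \<longleftrightarrow> (\<exists>x. optimality_conds n v ubar x)) \<and>
    (\<forall>ubar x. ubar \<in> Sol n v \<longrightarrow> optimality_conds n v ubar x \<longrightarrow> ubar \<notin> v ` {1..n} \<longrightarrow>
       Sol n v =
         (\<Inter>i\<in>{1..n}. {u. blinfun_apply (x i) (u - v i) = norm (x i) * norm (u - v i)}))"
  using Sol_imp_optimality_conds[OF assms] optimality_conds_imp_Sol Sol_eq_Inter by blast

end
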